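(* Let $\mu$ be a positive finite Borel measure on $(0,1)$. Let $1\le p<\infty$ and let $\alpha,\beta$ be real numbers with $\alpha>-1$, $\beta>-1$ and $\beta-\alpha>-1$. Define weights on $\mathbb{N}_0$ by $$w_1(m)=\big[(m+1)_{\alpha}\big]^{-p}(m+1)_{\beta},\qquad w_2(m)=\big[(m+\beta-\alpha+1)_{\alpha}\big]^{-p}(m+1)_{\beta},\qquad m\in\mathbb{N}_0.$$ Then the operator $H_{\mu}^{\alpha,\beta}$ is bounded from $l^p_{w_1}$ into $l^p_{w_2}$ if and only if $$\mathcal{C}_{\mu}(\beta,p):=\int_{(0,1)}(1-t)^{-(1-\frac1p)(\beta+1)}\,t^{-\frac1p(\beta+1)}\,d\mu(t)<\infty.$$ Moreover, when $H_{\mu}^{\alpha,\beta}:l^p_{w_1}\to l^p_{w_2}$ is bounded, its operator norm is $\|H_{\mu}^{\alpha,\beta}\|=\mathcal{C}_{\mu}(\beta,p)$.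
   Context: $\mathbb{N}_0=\{0,1,2,\dots\}$ and $\Gamma$ is the Gamma function. For real numbers $\gamma,s$ with $\gamma>-1$ and $\gamma+s>-1$, put $(\gamma+1)_s:=\dfrac{\Gamma(\gamma+s+1)}{\Gamma(\gamma+1)}$ (so e.g. $(m+1)_\alpha=\Gamma(m+\alpha+1)/\Gamma(m+1)$ and $(m+\beta-\alpha+1)_\alpha=\Gamma(m+\beta+1)/\Gamma(m+\beta-\alpha+1)$). For a weight $w:\mathbb{N}_0\to[0,\infty)$ and $1\le p<\infty$, $l^p_w$ is the space of complex sequences $a=\{a_n\}_{n=0}^\infty$ with $\|a\|_{p,w}=\big(\sum_{n=0}^\infty w(n)|a_n|^p\big)^{1/p}<\infty$. For $\alpha,\beta>-1$ with $\beta-\alpha>-1$, a positive finite Borel measure $\mu$ on $(0,1)$ and a complex sequence $a=\{a_m\}_{m=0}^\infty$, the generalized Hilbert matrix operator is $$H_{\mu}^{\alpha,\beta}(a)(n):=\sum_{m=0}^{\infty}\int_{(0,1)}\frac{\Gamma(n+m+\beta+1)}{\Gamma(m+\alpha+1)\Gamma(n+\beta-\alpha+1)}\,t^m(1-t)^n a_m\,d\mu(t),\qquad n\in\mathbb{N}_0.$$ Bounded from $X$ into $Y$ means: for every $a\in X$ the series defining $H_\mu^{\alpha,\beta}(a)(n)$ converges for every $n$, and there is a constant $C$ with $\|H_\mu^{\alpha,\beta}(a)\|_Y\le C\|a\|_X$ for all $a\in X$; the norm is the least such $C$. *)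

theory Defs
  imports "HOL-Analysis.Analysis"
begin

text \<open>The generalized Pochhammer symbol \<open>(x)\<^sub>s\<close> with a real index \<open>s\<close>; the library's
  \<^const>\<open>pochhammer\<close> only covers \<open>s \<in> \<nat>\<close>.\<close>
definition gpoch :: "real \<Rightarrow> real \<Rightarrow> real" where
  "gpoch x s = Gamma (x + s) / Gamma x"

definition lp_space :: "real \<Rightarrow> (nat \<Rightarrow> real) \<Rightarrow> (nat \<Rightarrow> complex) set" where
  "lp_space p w = {a. summable (\<lambda>n. w n * norm (a n) powr p)}"

definition lp_norm :: "real \<Rightarrow> (nat \<Rightarrow> real) \<Rightarrow> (nat \<Rightarrow> complex) \<Rightarrow> real" where
  "lp_norm p w a = (\<Sum>n. w n * norm (a n) powr p) powr (1 / p)"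

definition hilbert_term ::
  "real measure \<Rightarrow> real \<Rightarrow> real \<Rightarrow> (nat \<Rightarrow> complex) \<Rightarrow> nat \<Rightarrow> nat \<Rightarrow> complex" where
  "hilbert_term \<mu> \<alpha> \<beta> a n m =
     (LINT t|\<mu>. complex_of_real
        (Gamma (real n + real m + \<beta> + 1) /
           (Gamma (real m + \<alpha> + 1) * Gamma (real n + \<beta> - \<alpha> + 1))
         * t ^ m * (1 - t) ^ n) * a m)"

definition hilbert_op ::
  "real measure \<Rightarrow> real \<Rightarrow> real \<Rightarrow> (nat \<Rightarrow> complex) \<Rightarrow> nat \<Rightarrow> complex" where
  "hilbert_op \<mu> \<alpha> \<beta> a n = (\<Sum>m. hilbert_term \<mu> \<alpha> \<beta> a n m)"

text \<open>The membership \<open>T a \<in> lp_space p v\<close> says that the target norm is finite; it is needed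
  because \<^const>\<open>lp_norm\<close> is real-valued and carries no information for divergent sums.\<close>
definition lp_bound ::
  "real \<Rightarrow> (nat \<Rightarrow> real) \<Rightarrow> (nat \<Rightarrow> real) \<Rightarrow> ((nat \<Rightarrow> complex) \<Rightarrow> nat \<Rightarrow> complex) \<Rightarrow> real \<Rightarrow> bool" where
  "lp_bound p w v T C \<longleftrightarrow> 0 \<le> C \<and>
     (\<forall>a\<in>lp_space p w. T a \<in> lp_space p v \<and> lp_norm p v (T a) \<le> C * lp_norm p w a)"

definition hilbert_bounded ::
  "real \<Rightarrow> (nat \<Rightarrow> real) \<Rightarrow> (nat \<Rightarrow> real) \<Rightarrow> real measure \<Rightarrow> real \<Rightarrow> real \<Rightarrow> bool" where
  "hilbert_bounded p w v \<mu> \<alpha> \<beta> \<longleftrightarrow>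
     (\<forall>a\<in>lp_space p w. \<forall>n. summable (hilbert_term \<mu> \<alpha> \<beta> a n)) \<and>
     (\<exists>C. lp_bound p w v (hilbert_op \<mu> \<alpha> \<beta>) C)"

definition lp_opnorm ::
  "real \<Rightarrow> (nat \<Rightarrow> real) \<Rightarrow> (nat \<Rightarrow> real) \<Rightarrow> ((nat \<Rightarrow> complex) \<Rightarrow> nat \<Rightarrow> complex) \<Rightarrow> real" where
  "lp_opnorm p w v T = (LEAST C. lp_bound p w v T C)"

definition weight1 :: "real \<Rightarrow> real \<Rightarrow> real \<Rightarrow> nat \<Rightarrow> real" where
  "weight1 p \<alpha> \<beta> m = gpoch (real m + 1) \<alpha> powr (- p) * gpoch (real m + 1) \<beta>"

definition weight2 :: "real \<Rightarrow> real \<Rightarrow> real \<Rightarrow> nat \<Rightarrow> real" where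
  "weight2 p \<alpha> \<beta> m = gpoch (real m + \<beta> - \<alpha> + 1) \<alpha> powr (- p) * gpoch (real m + 1) \<beta>"

definition C_const :: "real measure \<Rightarrow> real \<Rightarrow> real \<Rightarrow> ennreal" where
  "C_const \<mu> \<beta> p =
     (\<integral>\<^sup>+ t. ennreal ((1 - t) powr (- (1 - 1 / p) * (\<beta> + 1)) * t powr (- (1 / p) * (\<beta> + 1))) \<partial>\<mu>)"

end

theory Submission
  imports Defs
begin

text \<open>With \<open>b = \<beta> + 1\<close>, diagonal scaling removes \<open>\<alpha>\<close> and both weights become
  \<open>v(m) = \<Gamma>(m + b) / m!\<close>, while the operator becomes the average over \<open>\<mu>\<close> of the matrices
  \<open>K\<^sub>t(n,m) = \<Gamma>(n + m + b) / (m! \<Gamma>(n + b)) t^m (1 - t)^n\<close>. These are, up to the factor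
  \<open>(1 - t)^(-b)\<close>, negative binomial distributions in \<open>m\<close>, and \<open>v(n) K\<^sub>t(n,m) = v(m) K\<^bsub>1-t\<^esub>(m,n)\<close>.
  So the row sums of \<open>K\<^sub>t\<close> are \<open>(1 - t)^(-b)\<close> and its \<open>v\<close>-weighted column sums \<open>v(m) t^(-b)\<close>.

  The upper bound is a Schur test for the joint kernel in \<open>(t,m)\<close> with test function
  \<open>\<phi>(t) = (t / (1 - t))^(-b/p)\<close>. For the lower bound take \<open>a(m) = (m + 1)^(-s)\<close> with
  \<open>s = (b + \<epsilon>) / p\<close>. Since \<open>x^(-s)\<close> is convex, Jensen's inequality for the negative binomial
  distribution bounds \<open>K\<^sub>t a (n)\<close> below by
  \<open>(1 - t)^(-b) (t / (1 - t))^(-s) (n + b + (1 - t) / t)^(-s)\<close>. For \<open>t \<ge> \<delta>\<close> the last factor is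
  asymptotically \<open>a(n)\<close>, and as \<open>\<epsilon> \<rightarrow> 0\<close> the norm of \<open>a\<close> concentrates at infinity. Fatou's lemma
  for \<open>\<epsilon> \<rightarrow> 0\<close> and then \<open>\<delta> \<rightarrow> 0\<close> yields the full constant.\<close>

section \<open>The negative binomial kernel\<close>

text \<open>With b = \<beta> + 1 this is the integrand of \<open>hilbert_term\<close> for \<alpha> =
  0, without the factor \<open>a m\<close>.\<close>

definition kern :: "real \<Rightarrow> nat \<Rightarrow> nat \<Rightarrow> real \<Rightarrow> real" where
  "kern b n m t = Gamma (real n + real m + b) / (fact m * Gamma (real n + b)) * t ^ m * (1 - t) ^ n"

definition wt :: "real \<Rightarrow> nat \<Rightarrow> real" where
  "wt b m = Gamma (real m + b) / fact m"

lemma wt_pos: "b > 0 \<Longrightarrow> wt b m > 0"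
  by (simp add: wt_def Gamma_real_pos)

lemma kern_nonneg: "b > 0 \<Longrightarrow> t \<in> {0<..<1} \<Longrightarrow> kern b n m t \<ge> 0"
  by (auto simp: kern_def intro!: mult_nonneg_nonneg divide_nonneg_nonneg Gamma_real_nonneg)

lemma kern_measurable [measurable]: "kern b n m \<in> borel_measurable borel"
  unfolding kern_def by measurable

text \<open>The common value is \<Gamma>(n + m + b) / (n! m!) t^m (1 - t)^n, which is invariant
  under exchanging n with m and t with 1 - t. This turns every statement about rows into one about
  weighted columns.\<close>

lemma kern_reflect:
  assumes "b > 0"
  shows "wt b n * kern b n m t = wt b m * kern b m n (1 - t)"
proof -
  have "Gamma (real n + b) > 0" "Gamma (real m + b) > 0"
    using assms by (simp_all add: Gamma_real_pos)
  then show ?thesis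
    by (simp add: wt_def kern_def divide_simps add_ac)
qed

text \<open>Newton's binomial series at -t with exponent -c; the signs of (-c choose m) and of
  (-t)^m cancel, and the remaining rising factorial is a quotient of Gamma values.\<close>

lemma negative_binomial_sums:
  fixes c t :: real
  assumes "c > 0" "t \<in> {0<..<1}"
  shows "(\<lambda>m. Gamma (c + real m) / (fact m * Gamma c) * t ^ m) sums (1 - t) powr (-c)"
proof -
  have "(\<lambda>m. ((-c) gchoose m) * (-t) ^ m) sums (1 + (-t)) powr (-c)"
    using assms by (intro gen_binomial_real) auto
  moreover have "((-c) gchoose m) * (-t) ^ m = Gamma (c + real m) / (fact m * Gamma c) * t ^ m" for m
  proof -
    have "(-1) ^ m * (- t) ^ m = t ^ m" by (simp flip: power_mult_distrib)
    moreover have "pochhammer c m = Gamma (c + real m) / Gamma c"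
      using assms by (intro pochhammer_Gamma) (auto dest: nonpos_Ints_nonpos)
    ultimately show ?thesis
      by (simp add: gbinomial_pochhammer mult_ac)
  qed
  ultimately show ?thesis by simp
qed

lemma kern_sums:
  assumes "b > 0" "t \<in> {0<..<1}"
  shows "(\<lambda>m. kern b n m t) sums (1 - t) powr (-b)"
proof -
  have "(\<lambda>m. Gamma ((real n + b) + real m) / (fact m * Gamma (real n + b)) * t ^ m * (1 - t) ^ n)
      sums ((1 - t) powr (-(real n + b)) * (1 - t) ^ n)"
    using assms by (intro sums_mult2 negative_binomial_sums) auto
  moreover have "(1 - t) powr (-(real n + b)) * (1 - t) ^ n = (1 - t) powr (-b)"
    using assms by (simp add: powr_realpow[symmetric] powr_add[symmetric])
  ultimately show ?thesis by (simp add: kern_def add_ac)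
qed

lemma wt_kern_sums:
  assumes "b > 0" "t \<in> {0<..<1}"
  shows "(\<lambda>n. wt b n * kern b n m t) sums (wt b m * t powr (-b))"
  using sums_mult[OF kern_sums[of b "1 - t" m], of "wt b m"] assms
  by (simp flip: kern_reflect)

text \<open>The factor m cancels against m!, so after an index shift the series is again a binomial
  series, with parameter c + 1 in place of c = n + b.\<close>

lemma kern_mean_sums:
  assumes "b > 0" "t \<in> {0<..<1}"
  shows "(\<lambda>m. real m * kern b n m t) sums ((real n + b) * (t / (1 - t)) * (1 - t) powr (-b))"
proof -
  define c where "c = real n + b"
  have c: "c > 0" using assms by (simp add: c_def)
  then have G: "Gamma c > 0" "Gamma (c + 1) = c * Gamma c"
    using Gamma_plus1[of c] nonpos_Ints_nonpos[of c] by (auto simp: Gamma_real_pos)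
  have "(\<lambda>m. Gamma ((c + 1) + real m) / (fact m * Gamma (c + 1)) * t ^ m * (c * t * (1 - t) ^ n))
      sums ((1 - t) powr (-(c + 1)) * (c * t * (1 - t) ^ n))"
    using assms c by (intro sums_mult2 negative_binomial_sums) auto
  also have "(\<lambda>m. Gamma ((c + 1) + real m) / (fact m * Gamma (c + 1)) * t ^ m * (c * t * (1 - t) ^ n))
      = (\<lambda>m. real (Suc m) * kern b n (Suc m) t)"
    using c G by (auto simp: fun_eq_iff kern_def c_def divide_simps add_ac)
  also have "(1 - t) powr (-(c + 1)) * (c * t * (1 - t) ^ n)
      = c * t * (1 - t) powr (-b - 1)"
    using assms by (simp add: powr_realpow[symmetric] powr_add[symmetric] c_def)
  also have "\<dots> = (real n + b) * (t / (1 - t)) * (1 - t) powr (-b)"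
    using assms by (simp add: c_def powr_diff)
  \<comment> \<open>The series was summed from m = 1 on; the term at m = 0 vanishes because of the
    factor m.\<close>
  finally show ?thesis
    by (rule sums_Suc_imp[rotated]) simp
qed

text \<open>The right-hand side is the tangent of the convex function x^(-s) at x0. With u = x / x0
  the bound follows from ln u \<le> u - 1 and exp v \<ge> 1 + v, so no derivatives are
  needed.\<close>

lemma powr_minus_ge_tangent:
  fixes x x0 s :: real
  assumes "x > 0" "x0 > 0" "s \<ge> 0"
  shows "x powr (-s) \<ge> x0 powr (-s) * (1 - s * (x / x0 - 1))"
proof -
  have "1 - s * (x / x0 - 1) \<le> 1 - s * ln (x / x0)"
    using ln_le_minus_one[of "x / x0"] assms by (auto intro!: mult_left_mono)
  also have "\<dots> \<le> (x / x0) powr (-s)"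
    using assms exp_ge_add_one_self[of "-s * ln (x / x0)"] by (simp add: powr_def)
  finally have "x0 powr (-s) * (1 - s * (x / x0 - 1)) \<le> x0 powr (-s) * (x / x0) powr (-s)"
    by (rule mult_left_mono) simp
  then show ?thesis using assms by (simp add: powr_divide)
qed

lemma kern_jensen:
  assumes b: "b > 0" and t: "t \<in> {0<..<1}" and s: "s \<ge> 0"
  shows "summable (\<lambda>m. kern b n m t * (real m + 1) powr (-s))"
    and "(1 - t) powr (-b) * ((real n + b) * (t / (1 - t)) + 1) powr (-s)
      \<le> (\<Sum>m. kern b n m t * (real m + 1) powr (-s))"
proof -
  \<comment> \<open>The tangent is taken at the mean of m + 1 under the normalized distribution;
    \<open>N\<close> is the total mass.\<close>
  define x0 where "x0 = (real n + b) * (t / (1 - t)) + 1"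
  define N where "N = (1 - t) powr (-b)"
  have x0: "x0 > 0"
    using b t by (auto simp: x0_def intro!: add_nonneg_pos)
  show sm: "summable (\<lambda>m. kern b n m t * (real m + 1) powr (-s))"
  proof (rule summable_comparison_test')
    show "summable (\<lambda>m. kern b n m t)" using kern_sums[OF b t] by (rule sums_summable)
    show "norm (kern b n m t * (real m + 1) powr (-s)) \<le> kern b n m t" for m
      using kern_nonneg[OF b t, of n m] s
      by (auto simp: abs_mult powr_minus intro!: mult_left_le ge_one_powr_ge_zero inverse_le_1_iff[THEN iffD2])
  qed
  \<comment> \<open>This series sums the tangent line at m + 1 against the kernel, split into its
    constant and its linear part. Since x0 is the mean, the deviation averages to zero and only
    x0^(-s) N is left.\<close>
  have "(\<lambda>m. x0 powr (-s) * ((1 + s - s / x0) * kern b n m t - (s / x0) * (real m * kern b n m t)))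
     sums (x0 powr (-s) * ((1 + s - s / x0) * N - (s / x0) * ((real n + b) * (t / (1 - t)) * N)))"
    unfolding N_def using b t by (intro sums_mult sums_diff kern_sums kern_mean_sums)
  moreover have "(1 + s - s / x0) * N - (s / x0) * ((real n + b) * (t / (1 - t)) * N) = N"
  proof -
    have "(real n + b) * (t / (1 - t)) = x0 - 1" by (simp add: x0_def)
    then show ?thesis using x0 by (simp only:) (simp add: field_simps)
  qed
  ultimately have "(\<lambda>m. x0 powr (-s) * ((1 + s - s / x0) * kern b n m t - (s / x0) * (real m * kern b n m t)))
     sums (x0 powr (-s) * N)" by simp
  then have "x0 powr (-s) * N \<le> (\<Sum>m. kern b n m t * (real m + 1) powr (-s))"
  proof (rule sums_le[rotated, OF _ summable_sums[OF sm]])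
    fix m
    have "x0 powr (-s) * (1 - s * ((real m + 1) / x0 - 1)) * kern b n m t \<le> (real m + 1) powr (-s) * kern b n m t"
      using x0 s kern_nonneg[OF b t] by (intro mult_right_mono powr_minus_ge_tangent) auto
    then show "x0 powr (-s) * ((1 + s - s / x0) * kern b n m t - (s / x0) * (real m * kern b n m t))
       \<le> kern b n m t * (real m + 1) powr (-s)"
      by (simp add: algebra_simps add_divide_distrib)
  qed
  then show "(1 - t) powr (-b) * ((real n + b) * (t / (1 - t)) + 1) powr (-s)
      \<le> (\<Sum>m. kern b n m t * (real m + 1) powr (-s))"
    by (simp add: N_def x0_def mult.commute)
qed

section \<open>Asymptotics of the weights and Young's inequality\<close>

text \<open>\<Gamma>(n + b) / n! grows like n^(b - 1) by the product formula for \<Gamma>(b); the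
  factor (n / (n + 1))^(b - 1) passes from powers of n to powers of n + 1.\<close>

lemma wt_asymp:
  assumes "b > 0"
  shows "(\<lambda>n. wt b n * (real n + 1) powr (1 - b)) \<longlonglongrightarrow> 1"
proof -
  have Gb: "Gamma b > 0" using assms by (simp add: Gamma_real_pos)
  have "(\<lambda>n. Gamma b / Gamma_series' b n) \<longlonglongrightarrow> Gamma b / Gamma b"
    using Gb by (intro tendsto_intros Gamma_series'_LIMSEQ) auto
  moreover have "(\<lambda>n. (real n / real (Suc n)) powr (b - 1)) \<longlonglongrightarrow> 1 powr (b - 1)"
    by (intro tendsto_powr LIMSEQ_n_over_Suc_n tendsto_const) auto
  ultimately have "(\<lambda>n. Gamma b / Gamma_series' b n * (real n / real (Suc n)) powr (b - 1))
      \<longlonglongrightarrow> Gamma b / Gamma b * 1 powr (b - 1)"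
    by (intro tendsto_mult)
  \<comment> \<open>The identity is claimed only for n > 0, since \<open>Gamma_series'\<close>
    involves (n - 1)! and ln n.\<close>
  moreover have "\<forall>\<^sub>F n in sequentially. Gamma b / Gamma_series' b n * (real n / real (Suc n)) powr (b - 1)
      = wt b n * (real n + 1) powr (1 - b)"
    using eventually_gt_at_top[of 0]
  proof eventually_elim
    fix n :: nat assume n: "n > 0"
    have "Gamma (b + real n) > 0" using assms by (simp add: Gamma_real_pos)
    moreover have "pochhammer b n = Gamma (b + real n) / Gamma b"
      using assms by (intro pochhammer_Gamma) (auto dest: nonpos_Ints_nonpos)
    then have "Gamma b * pochhammer b n = Gamma (b + real n)"
      using Gb by simp
    moreover have "real n powr (b - 1) = exp (b * ln (real n)) / real n"
      using n by (simp add: powr_def left_diff_distrib exp_diff)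
    moreover have "(fact n :: real) = real n * fact (n - 1)"
      using n by (simp add: fact_reduce)
    moreover have "(1 + real n) powr (1 - b) * (1 + real n) powr (b - 1) = 1"
      by (simp flip: powr_add)
    ultimately show "Gamma b / Gamma_series' b n * (real n / real (Suc n)) powr (b - 1)
      = wt b n * (real n + 1) powr (1 - b)"
      using n Gb by (simp add: Gamma_series'_def wt_def powr_divide divide_simps add_ac mult.assoc)
  qed
  ultimately show ?thesis
    using Gb by (auto intro: Lim_transform_eventually)
qed

lemma summable_wt_powr:
  assumes b: "b > 0" and e: "e > 0"
  shows "summable (\<lambda>n. wt b n * (real n + 1) powr (-(b + e)))"
proof (rule summable_comparison_test_ev)
  have "\<forall>\<^sub>F n in sequentially. wt b n * (real n + 1) powr (1 - b) < 2"
    by (rule order_tendstoD(2)[OF wt_asymp[OF b]]) simp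
  then show "\<forall>\<^sub>F n in sequentially. norm (wt b n * (real n + 1) powr (-(b + e)))
      \<le> 2 * (real n + 1) powr (- 1 - e)"
  proof eventually_elim
    fix n :: nat assume "wt b n * (real n + 1) powr (1 - b) < 2"
    then have "wt b n * (real n + 1) powr (1 - b) * (real n + 1) powr (-1 - e)
        \<le> 2 * (real n + 1) powr (-1 - e)"
      by (intro mult_right_mono) auto
    then show "norm (wt b n * (real n + 1) powr (-(b + e))) \<le> 2 * (real n + 1) powr (- 1 - e)"
      using wt_pos[OF b, of n] by (simp add: mult.assoc flip: powr_add)
  qed
  have "summable (\<lambda>n. real (Suc n) powr (- 1 - e))"
    using e by (subst summable_Suc_iff) (simp add: summable_real_powr_iff)
  then show "summable (\<lambda>n. 2 * (real n + 1) powr (- 1 - e))"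
    by (intro summable_mult) (simp add: add_ac)
qed

text \<open>The terms are asymptotic to 1 / (n + 1), so the harmonic series is a minorant up to a
  factor 2. This divergence at the critical exponent is what pushes the mass of the test sequences
  to infinity.\<close>

lemma not_summable_wt_powr:
  assumes b: "b > 0"
  shows "\<not> summable (\<lambda>n. wt b n * (real n + 1) powr (-b))"
proof
  assume "summable (\<lambda>n. wt b n * (real n + 1) powr (-b))"
  then have "summable (\<lambda>n. 2 * (wt b n * (real n + 1) powr (-b)))"
    by (rule summable_mult)
  moreover have "\<forall>\<^sub>F n in sequentially. wt b n * (real n + 1) powr (1 - b) > 1 / 2"
    by (rule order_tendstoD(1)[OF wt_asymp[OF b]]) simp
  then have "\<forall>\<^sub>F n in sequentially. norm (inverse (of_nat (Suc n)) :: real)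
      \<le> 2 * (wt b n * (real n + 1) powr (-b))"
  proof eventually_elim
    fix n :: nat assume "wt b n * (real n + 1) powr (1 - b) > 1 / 2"
    moreover have "wt b n * (real n + 1) powr (1 - b) = wt b n * (real n + 1) powr (-b) * (real n + 1)"
      using powr_add[of "real n + 1" "-b" 1] by (simp add: mult.assoc add_ac)
    ultimately show "norm (inverse (of_nat (Suc n)) :: real) \<le> 2 * (wt b n * (real n + 1) powr (-b))"
      by (simp add: field_simps)
  qed
  ultimately have "summable (\<lambda>n. inverse (of_nat (Suc n)) :: real)"
    by (rule summable_comparison_test_ev[rotated])
  then show False
    using not_summable_harmonic[where 'a=real] by (subst (asm) summable_Suc_iff) simp
qed

lemma summable_wt_powr_shift:
  assumes b: "b > 0" and e: "e > 0" and c: "c \<ge> 1"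
  shows "summable (\<lambda>n. wt b n * (real n + c) powr (-(b + e)))"
proof (rule summable_comparison_test'[OF summable_wt_powr[OF b e]])
  show "norm (wt b n * (real n + c) powr (-(b + e))) \<le> wt b n * (real n + 1) powr (-(b + e))" for n
    using wt_pos[OF b, of n] b e c by (auto simp: abs_mult intro!: mult_left_mono powr_mono2')
qed

text \<open>Replacing n + 1 by n + c changes late terms by a factor close to 1, uniformly in k. The
  early terms stay bounded while the full sums grow without bound as \<open>e k\<close> tends to 0,
  so they become negligible.\<close>

lemma wt_powr_shift_asymp:
  fixes e :: "nat \<Rightarrow> real"
  assumes b: "b > 0" and e: "e \<longlonglongrightarrow> 0" "\<And>k. 0 < e k" "\<And>k. e k \<le> 1"
    and c: "c \<ge> 1" and \<theta>: "0 < \<theta>" "\<theta> < 1"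
  shows "\<forall>\<^sub>F k in sequentially. \<theta> * (\<Sum>n. wt b n * (real n + 1) powr (-(b + e k)))
     \<le> (\<Sum>n. wt b n * (real n + c) powr (-(b + e k)))"
proof -
  \<comment> \<open>The ratio on the tail is controlled by \<eta>; the gap between \<theta> and
    \<eta> pays for the discarded head.\<close>
  obtain \<eta> where \<eta>: "\<theta> < \<eta>" "\<eta> < 1" using dense \<theta> by blast
  \<comment> \<open>The exponent b + 1 dominates every b + \<open>e k\<close>, and the base is at
    most 1, so the \<open>N\<close> found here serves all k at once.\<close>
  have "(\<lambda>n. ((real n + 1) / (real n + c)) powr (b + 1)) \<longlonglongrightarrow> 1 powr (b + 1)"
  proof (intro tendsto_powr tendsto_const)
    have "(\<lambda>n. 1 + (1 - c) / (real n + c)) \<longlonglongrightarrow> 1 + 0"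
      by (intro tendsto_add tendsto_const tendsto_divide_0[OF tendsto_const]
          filterlim_at_top_imp_at_infinity filterlim_tendsto_add_at_top[OF tendsto_const, of _ _ c, unfolded add.commute[of c]]
          filterlim_real_sequentially)
    moreover have "1 + (1 - c) / (real n + c) = (real n + 1) / (real n + c)" for n
      using c by (simp add: field_simps)
    ultimately show "(\<lambda>n. (real n + 1) / (real n + c)) \<longlonglongrightarrow> 1" by simp
  qed auto
  then have "\<forall>\<^sub>F n in sequentially. ((real n + 1) / (real n + c)) powr (b + 1) > \<eta>"
    using \<eta> by (intro order_tendstoD(1)) auto
  then obtain N where N: "\<And>n. n \<ge> N \<Longrightarrow> ((real n + 1) / (real n + c)) powr (b + 1) > \<eta>"
    by (auto simp: eventually_sequentially)
  define f where "f = (\<lambda>k n. wt b n * (real n + 1) powr (-(b + e k)))"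
  define g where "g = (\<lambda>k n. wt b n * (real n + c) powr (-(b + e k)))"
  define f0 where "f0 = (\<lambda>n. wt b n * (real n + 1) powr (-b))"
  have sf: "summable (f k)" and sg: "summable (g k)" for k
    unfolding f_def g_def using summable_wt_powr summable_wt_powr_shift b c e by auto
  have nonneg: "f k n \<ge> 0" "g k n \<ge> 0" "f0 n \<ge> 0" for k n
    using wt_pos[OF b, of n] by (auto simp: f_def g_def f0_def)
  have ff0: "f k n \<le> f0 n" for k n
    using wt_pos[OF b, of n] e(2)[of k] by (auto simp: f_def f0_def intro!: mult_left_mono powr_mono)
  have gf: "\<eta> * f k n \<le> g k n" if "n \<ge> N" for k n
  proof -
    have "((real n + 1) / (real n + c)) powr (b + 1) \<le> ((real n + 1) / (real n + c)) powr (b + e k)"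
      using c e(3)[of k] by (intro powr_mono') auto
    then have "\<eta> \<le> ((real n + 1) / (real n + c)) powr (b + e k)"
      using N[OF that] by simp
    then have "\<eta> * (real n + 1) powr (-(b + e k))
        \<le> ((real n + 1) / (real n + c)) powr (b + e k) * (real n + 1) powr (-(b + e k))"
      by (intro mult_right_mono) auto
    also have "\<dots> = (real n + c) powr (-(b + e k))"
      using c by (simp add: powr_divide powr_minus divide_simps del: minus_add_distrib)
    finally show ?thesis
      using wt_pos[OF b, of n] by (simp add: f_def g_def mult.left_commute[of \<eta>] mult_left_mono)
  qed
  \<comment> \<open>A bound for the head of every \<open>f k\<close> that does not depend on k,
    since \<open>f k\<close> lies below \<open>f0\<close>.\<close>
  define F where "F = sum f0 {..<N}"
  have lower: "\<eta> * (suminf (f k) - F) \<le> suminf (g k)" for k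
  proof -
    have "suminf (f k) - F \<le> suminf (f k) - sum (f k) {..<N}"
      unfolding F_def using ff0 by (intro diff_left_mono sum_mono)
    also have "\<dots> = (\<Sum>n. f k (n + N))"
      using suminf_split_initial_segment[OF sf, of k N] by simp
    finally have "\<eta> * (suminf (f k) - F) \<le> \<eta> * (\<Sum>n. f k (n + N))"
      using \<eta> \<theta> by (intro mult_left_mono) auto
    also have "\<dots> = (\<Sum>n. \<eta> * f k (n + N))"
      using sf by (intro suminf_mult[symmetric]) (simp add: summable_iff_shift)
    also have "\<dots> \<le> (\<Sum>n. g k (n + N))"
      using sf sg gf by (intro suminf_le summable_mult) (auto simp: summable_iff_shift)
    also have "\<dots> \<le> suminf (g k)"
      using suminf_split_initial_segment[OF sg, of k N] sum_nonneg[of "{..<N}" "g k"] nonneg by simp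
    finally show ?thesis .
  qed
  \<comment> \<open>The threshold is the solution S of \<eta> (S - F) = \<theta> S; beyond it the
    estimate \<open>lower\<close> gives the claim.\<close>
  define R where "R = \<eta> * F / (\<eta> - \<theta>)"
  obtain K where K: "sum f0 {..<K} > R"
  proof (rule ccontr)
    assume "\<not> thesis"
    then have "sum f0 {..<Suc k} \<le> R" for k using that by (meson not_le)
    then have "summable f0"
      by (intro bounded_imp_summable[of f0 R] nonneg) (simp add: lessThan_Suc_atMost)
    then show False using not_summable_wt_powr[OF b] by (simp add: f0_def)
  qed
  \<comment> \<open>A finite sum passes to the limit termwise, so the large partial sum of
    \<open>f0\<close> is inherited by \<open>f k\<close> for all late k.\<close>
  have "(\<lambda>k. sum (f k) {..<K}) \<longlonglongrightarrow> (\<Sum>n<K. wt b n * (real n + 1) powr (-(b + 0)))"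
    unfolding f_def by (intro tendsto_intros e) auto
  then have "\<forall>\<^sub>F k in sequentially. sum (f k) {..<K} > R"
    using K by (intro order_tendstoD(1)) (auto simp: f0_def)
  then show ?thesis
  proof eventually_elim
    fix k assume "sum (f k) {..<K} > R"
    then have "R \<le> suminf (f k)"
      using sum_le_suminf[OF sf, of "{..<K}" k] nonneg by force
    then have "\<eta> * F \<le> (\<eta> - \<theta>) * suminf (f k)"
      using \<eta> by (simp add: R_def field_simps)
    with lower[of k] have "\<theta> * suminf (f k) \<le> suminf (g k)"
      by (simp add: algebra_simps)
    then show "\<theta> * (\<Sum>n. wt b n * (real n + 1) powr (-(b + e k)))
     \<le> (\<Sum>n. wt b n * (real n + c) powr (-(b + e k)))"
      by (simp add: f_def g_def)
  qed
qed

text \<open>Weighted arithmetic-geometric mean inequality for y and y^(1 - p) x^p, whose geometric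
  mean with weights 1 - 1/p and 1/p is x. It stands in for Hoelder's inequality and includes p =
  1.\<close>

lemma Youngs_inequality_scaled:
  fixes p x y :: real
  assumes "p \<ge> 1" "y > 0" "x \<ge> 0"
  shows "x \<le> (1 - 1 / p) * y + (1 / p) * (y powr (1 - p) * x powr p)"
proof (cases "x = 0")
  case False
  then have "(y powr (1 - p) * x powr p) powr (1 / p) * y powr (1 - 1 / p)
      \<le> (1 / p) * (y powr (1 - p) * x powr p) + (1 - 1 / p) * y"
    using assms by (intro Youngs_inequality_0) auto
  moreover have "(y powr (1 - p) * x powr p) powr (1 / p) * y powr (1 - 1 / p) = x"
  proof -
    have "(y powr (1 - p) * x powr p) powr (1 / p) = y powr (1 / p - 1) * x"
      using assms by (simp add: powr_mult powr_powr diff_divide_distrib)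
    moreover have "y powr (1 / p - 1) * y powr (1 - 1 / p) = 1"
      using assms by (simp flip: powr_add)
    ultimately show ?thesis by simp
  qed
  ultimately show ?thesis by simp
qed (use assms in auto)

text \<open>Optimizing over the free parameter l turns the additive bound back into the
  multiplicative form of Hoelder's inequality.\<close>

lemma Youngs_inequality_optimize:
  fixes p C x e :: real
  assumes p: "p \<ge> 1" and C: "C > 0" and nonneg: "x \<ge> 0" "e \<ge> 0"
    and le: "\<And>l. l > 0 \<Longrightarrow> x \<le> (1 - 1 / p) * l * C + (1 / p) * l powr (1 - p) * e"
  shows "x powr p \<le> C powr (p - 1) * e"
proof (cases "e = 0")
  case True
  have "x \<le> 0"
  proof (rule field_le_epsilon)
    fix d :: real assume "d > 0"
    \<comment> \<open>For e = 0 there is no positive optimal l; small values of l show x \<le> 0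
      instead.\<close>
    have "x \<le> (1 - 1 / p) * (d / C) * C"
      using le[of "d / C"] True \<open>d > 0\<close> C by simp
    also have "\<dots> \<le> d" using C p \<open>d > 0\<close> by (simp add: field_simps)
    finally show "x \<le> 0 + d" by simp
  qed
  then show ?thesis using True nonneg p by simp
next
  case False
  then have e: "e > 0" using nonneg by simp
  \<comment> \<open>At l^p = e / C both terms are multiples of l C, with coefficients adding up to
    1.\<close>
  define l where "l = (e / C) powr (1 / p)"
  have l: "l > 0" using e C by (simp add: l_def)
  have lp: "l powr p = e / C" using e C p by (simp add: l_def powr_powr)
  have "l powr (1 - p) * e = l * C"
    using l lp e C by (simp add: powr_diff)
  then have "x \<le> l * C"
    using le[OF l] by (simp add: algebra_simps)
  then have "x powr p \<le> (l * C) powr p"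
    using p nonneg by (intro powr_mono2) auto
  also have "\<dots> = C powr (p - 1) * e"
    using l C e by (simp add: powr_mult lp powr_diff)
  finally show ?thesis .
qed

section \<open>The Schur test\<close>

text \<open>Tonelli's theorem, with one of the sums read as an integral over the counting
  measure.\<close>

lemma suminf_commute_ennreal:
  fixes f :: "nat \<Rightarrow> nat \<Rightarrow> ennreal"
  shows "(\<Sum>i. \<Sum>j. f i j) = (\<Sum>j. \<Sum>i. f i j)"
  by (rule nn_integral_suminf[of "\<lambda>j i. f i j" "count_space UNIV", unfolded nn_integral_count_space_nat])
    simp

section \<open>Averages of the kernel over a finite measure on (0,1)\<close>

locale interval_measure = finite_measure \<mu> for \<mu> :: "real measure" +
  assumes sets_interval: "sets \<mu> = sets (restrict_space borel {0<..<1})"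
begin

lemma space_interval: "space \<mu> = {0<..<1}"
  using sets_eq_imp_space_eq[OF sets_interval] by (simp add: space_restrict_space)

lemma measurable_interval [measurable (raw)]: "f \<in> borel_measurable borel \<Longrightarrow> f \<in> borel_measurable \<mu>"
  by (subst measurable_cong_sets[OF sets_interval refl]) (rule measurable_restrict_space1)

definition kmat :: "real \<Rightarrow> nat \<Rightarrow> nat \<Rightarrow> real" where
  "kmat b n m = (LINT t|\<mu>. kern b n m t)"

text \<open>For fixed n and m the powers of t and 1 - t are at most 1, so finiteness of \<mu>
  suffices, whatever its behavior at the endpoints.\<close>

lemma kern_integrable:
  assumes "b > 0"
  shows "integrable \<mu> (kern b n m)"
proof (rule integrable_const_bound)
  define G where "G = Gamma (real n + real m + b) / (fact m * Gamma (real n + b))"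
  have G: "G \<ge> 0" unfolding G_def using assms
    by (intro divide_nonneg_nonneg mult_nonneg_nonneg Gamma_real_nonneg) auto
  show "AE t in \<mu>. norm (kern b n m t) \<le> G"
  proof (rule AE_I2)
    fix t assume "t \<in> space \<mu>"
    then have t: "0 \<le> t" "t \<le> 1" by (auto simp: space_interval)
    have "t ^ m * (1 - t) ^ n \<le> 1 * 1"
      using t by (intro mult_mono power_le_one) auto
    then have "G * (t ^ m * (1 - t) ^ n) \<le> G * 1"
      using G by (intro mult_left_mono) auto
    then show "norm (kern b n m t) \<le> G"
      using G t by (simp add: kern_def abs_mult mult.assoc flip: G_def)
  qed
qed measurable

lemma kmat_nonneg: "b > 0 \<Longrightarrow> kmat b n m \<ge> 0"
  unfolding kmat_def by (rule integral_nonneg_AE) (auto intro!: AE_I2 kern_nonneg simp: space_interval)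

lemma nn_integral_kern:
  assumes "b > 0"
  shows "(\<integral>\<^sup>+t. ennreal (kern b n m t) \<partial>\<mu>) = ennreal (kmat b n m)"
  unfolding kmat_def
  by (rule nn_integral_eq_integral[OF kern_integrable[OF assms]])
    (auto intro!: AE_I2 kern_nonneg assms simp: space_interval)

lemma nn_integral_kern_mult:
  assumes b: "b > 0" and a: "a \<ge> 0"
  shows "(\<integral>\<^sup>+t. ennreal (kern b n m t * a) \<partial>\<mu>) = ennreal (kmat b n m * a)"
proof -
  have "(\<integral>\<^sup>+t. ennreal (kern b n m t * a) \<partial>\<mu>) = (\<integral>\<^sup>+t. ennreal (kern b n m t) * ennreal a \<partial>\<mu>)"
    using kern_nonneg[OF b] a by (intro nn_integral_cong ennreal_mult) (auto simp: space_interval)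
  also have "\<dots> = ennreal (kmat b n m) * ennreal a"
    by (subst nn_integral_multc) (measurable, simp add: nn_integral_kern b)
  finally show ?thesis using kmat_nonneg[OF b] a by (simp add: ennreal_mult)
qed

lemma suminf_kmat:
  assumes b: "b > 0" and A: "\<And>m. A m \<ge> 0"
  shows "(\<Sum>m. ennreal (kmat b n m * A m)) = (\<integral>\<^sup>+t. (\<Sum>m. ennreal (kern b n m t * A m)) \<partial>\<mu>)"
  using A by (subst nn_integral_suminf) (measurable, simp add: nn_integral_kern_mult b)

text \<open>Young's inequality is applied under the integral with y = l \<phi>(t). Both resulting
  kernels integrate to at most C, one over rows and one over weighted columns, and l is optimized
  for each n separately.\<close>

lemma kmat_bound:
  assumes p: "p \<ge> 1" and b: "b > 0" and C: "C > 0"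
    and int: "(\<integral>\<^sup>+t. ennreal ((1 - t) powr (-(1 - 1 / p) * b) * t powr (-(1 / p) * b)) \<partial>\<mu>) \<le> ennreal C"
    and A: "\<And>m. A m \<ge> 0" and sA: "summable (\<lambda>m. wt b m * A m powr p)"
  shows "summable (\<lambda>m. kmat b n m * A m)"
    and "summable (\<lambda>n. wt b n * (\<Sum>m. kmat b n m * A m) powr p)"
    and "(\<Sum>n. wt b n * (\<Sum>m. kmat b n m * A m) powr p) \<le> C powr p * (\<Sum>m. wt b m * A m powr p)"
proof -
  define S where "S = (\<Sum>m. wt b m * A m powr p)"
  define h where "h = (\<lambda>t::real. (1 - t) powr (-(1 - 1 / p) * b) * t powr (-(1 / p) * b))"
  \<comment> \<open>The exponent is chosen so that (1 - t)^(-b) \<phi>(t) and t^(-b) \<phi>(t)^(1 -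
    p) are both equal to h(t).\<close>
  define \<phi> where "\<phi> = (\<lambda>t::real. (t / (1 - t)) powr (- b / p))"
  define q1 where "q1 = (\<lambda>n m. \<integral>\<^sup>+t. ennreal (kern b n m t * \<phi> t) \<partial>\<mu>)"
  define q2 where "q2 = (\<lambda>n m. \<integral>\<^sup>+t. ennreal (kern b n m t * \<phi> t powr (1 - p)) \<partial>\<mu>)"
  define E where "E = (\<lambda>n. \<Sum>m. q2 n m * ennreal (A m powr p))"
  have w: "wt b n \<ge> 0" for n using wt_pos[OF b, of n] by simp
  have S: "S \<ge> 0" unfolding S_def using w by (intro suminf_nonneg sA) auto
  have \<phi>: "\<phi> t > 0" if "t \<in> {0<..<1}" for t using that by (simp add: \<phi>_def)
  have [measurable]: "h \<in> borel_measurable borel" "\<phi> \<in> borel_measurable borel"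
    unfolding h_def \<phi>_def by measurable
  have q1: "(\<Sum>m. q1 n m) \<le> ennreal C" for n
  proof -
    have "(\<Sum>m. q1 n m) = (\<integral>\<^sup>+t. (\<Sum>m. ennreal (kern b n m t * \<phi> t)) \<partial>\<mu>)"
      unfolding q1_def by (rule nn_integral_suminf[symmetric]) measurable
    also have "\<dots> = (\<integral>\<^sup>+t. ennreal (h t) \<partial>\<mu>)"
    proof (rule nn_integral_cong)
      fix t assume "t \<in> space \<mu>"
      then have t: "t \<in> {0<..<1}" by (simp add: space_interval)
      have "(\<lambda>m. kern b n m t * \<phi> t) sums ((1 - t) powr (-b) * \<phi> t)"
        by (intro sums_mult2 kern_sums b t)
      moreover have "(1 - t) powr (-b) * \<phi> t = h t"
        using t by (simp add: \<phi>_def h_def powr_divide powr_minus powr_add[symmetric] powr_diff algebra_simps divide_simps)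
      ultimately show "(\<Sum>m. ennreal (kern b n m t * \<phi> t)) = ennreal (h t)"
        using kern_nonneg[OF b t] \<phi>[OF t] by (intro suminf_ennreal_eq) (auto intro: less_imp_le)
    qed
    finally show ?thesis using int by (simp add: h_def)
  qed
  have q2: "(\<Sum>n. ennreal (wt b n) * q2 n m) \<le> ennreal (wt b m) * ennreal C" for m
  proof -
    have "(\<Sum>n. ennreal (wt b n) * q2 n m) = (\<Sum>n. \<integral>\<^sup>+t. ennreal (wt b n * kern b n m t * \<phi> t powr (1 - p)) \<partial>\<mu>)"
      unfolding q2_def using w kern_nonneg[OF b]
      by (subst nn_integral_cmult[symmetric])
        (auto intro!: suminf_cong nn_integral_cong simp: ennreal_mult'[symmetric] mult.assoc)
    also have "\<dots> = (\<integral>\<^sup>+t. (\<Sum>n. ennreal (wt b n * kern b n m t * \<phi> t powr (1 - p))) \<partial>\<mu>)"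
      by (rule nn_integral_suminf[symmetric]) measurable
    also have "\<dots> = (\<integral>\<^sup>+t. ennreal (wt b m) * ennreal (h t) \<partial>\<mu>)"
    proof (rule nn_integral_cong)
      fix t assume "t \<in> space \<mu>"
      then have t: "t \<in> {0<..<1}" by (simp add: space_interval)
      have "(\<lambda>n. wt b n * kern b n m t * \<phi> t powr (1 - p)) sums (wt b m * t powr (-b) * \<phi> t powr (1 - p))"
        by (intro sums_mult2 wt_kern_sums b t)
      moreover have "t powr (-b) * \<phi> t powr (1 - p) = h t"
      proof -
        have "\<phi> t powr (1 - p) = (t / (1 - t)) powr (b - b / p)"
        proof -
          have "- b / p * (1 - p) = b - b / p" using p by (simp add: field_simps)
          then show ?thesis by (simp only: \<phi>_def powr_powr)
        qed
        also have "\<dots> = t powr (b - b / p) * (1 - t) powr (-(b - b / p))"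
          using t by (subst powr_divide) (auto simp: powr_minus divide_inverse simp del: minus_diff_eq)
        finally have "t powr (-b) * \<phi> t powr (1 - p)
            = (t powr (-b) * t powr (b - b / p)) * (1 - t) powr (-(b - b / p))" by simp
        also have "t powr (-b) * t powr (b - b / p) = t powr (-(b / p))"
          by (simp flip: powr_add)
        finally show ?thesis by (simp add: h_def algebra_simps)
      qed
      ultimately have "(\<lambda>n. wt b n * kern b n m t * \<phi> t powr (1 - p)) sums (wt b m * h t)"
        by (simp add: mult.assoc)
      then have "(\<Sum>n. ennreal (wt b n * kern b n m t * \<phi> t powr (1 - p))) = ennreal (wt b m * h t)"
        using kern_nonneg[OF b t] w by (intro suminf_ennreal_eq) auto
      then show "(\<Sum>n. ennreal (wt b n * kern b n m t * \<phi> t powr (1 - p))) = ennreal (wt b m) * ennreal (h t)"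
        using w by (simp add: ennreal_mult')
    qed
    also have "\<dots> = ennreal (wt b m) * (\<integral>\<^sup>+t. ennreal (h t) \<partial>\<mu>)"
      by (rule nn_integral_cmult) measurable
    finally show ?thesis using int by (simp add: h_def mult_left_mono)
  qed
  have E_total: "(\<Sum>n. ennreal (wt b n) * E n) \<le> ennreal (C * S)"
  proof -
    \<comment> \<open>Summing over n first makes the column bound \<open>q2\<close>
      available.\<close>
    have "(\<Sum>n. ennreal (wt b n) * E n) = (\<Sum>n. \<Sum>m. ennreal (wt b n) * q2 n m * ennreal (A m powr p))"
      unfolding E_def by (subst ennreal_suminf_cmult[symmetric]) (simp add: mult.assoc)
    also have "\<dots> = (\<Sum>m. (\<Sum>n. ennreal (wt b n) * q2 n m) * ennreal (A m powr p))"
      by (subst suminf_commute_ennreal) simp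
    also have "\<dots> \<le> (\<Sum>m. (ennreal (wt b m) * ennreal C) * ennreal (A m powr p))"
      by (intro suminf_le mult_right_mono q2) auto
    also have "\<dots> = ennreal C * (\<Sum>m. ennreal (wt b m * A m powr p))"
      using w by (subst ennreal_suminf_cmult[symmetric]) (simp add: ennreal_mult' mult_ac)
    also have "\<dots> = ennreal (C * S)"
      unfolding S_def using w C sA by (subst suminf_ennreal2) (auto simp: ennreal_mult' suminf_nonneg)
    finally show ?thesis .
  qed
  have E_fin: "E n \<noteq> top" for n
  proof
    assume "E n = top"
    then have "ennreal (wt b n) * E n = top"
      using wt_pos[OF b, of n] by (simp add: ennreal_mult_top)
    moreover have "ennreal (wt b n) * E n \<le> (\<Sum>n. ennreal (wt b n) * E n)"
      using sum_le_suminf[OF summableI, of "{n}" "\<lambda>n. ennreal (wt b n) * E n"] by simp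
    ultimately show False using E_total by (simp add: top_unique)
  qed
  define e where "e n = enn2real (E n)" for n
  have e: "ennreal (e n) = E n" "e n \<ge> 0" for n
    using E_fin[of n] by (auto simp: e_def less_top)
  \<comment> \<open>Working in \<open>ennreal\<close> postpones convergence: finiteness of the
    left-hand side, and with it the summability of the rows, is read off from this bound at l =
    1.\<close>
  have X: "(\<Sum>m. ennreal (kmat b n m * A m)) \<le> ennreal ((1 - 1 / p) * l * C + (1 / p) * l powr (1 - p) * e n)"
    if l: "l > 0" for n l
  proof -
    have split: "ennreal (c * x + d * (y * z)) = ennreal c * ennreal x + ennreal d * (ennreal y * ennreal z)"
      if "c \<ge> 0" "d \<ge> 0" "x \<ge> 0" "y \<ge> 0" "z \<ge> 0" for c d x y z :: real
      using that by (simp add: ennreal_mult)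
    have "(\<Sum>m. ennreal (kmat b n m * A m))
      \<le> (\<Sum>m. ennreal ((1 - 1 / p) * l) * q1 n m + ennreal ((1 / p) * l powr (1 - p)) * (q2 n m * ennreal (A m powr p)))"
    proof (intro suminf_le)
      fix m
      have "ennreal (kmat b n m * A m) = (\<integral>\<^sup>+t. ennreal (kern b n m t * A m) \<partial>\<mu>)"
        using nn_integral_kern_mult[OF b A] by simp
      also have "\<dots> \<le> (\<integral>\<^sup>+t. ennreal ((1 - 1 / p) * l) * ennreal (kern b n m t * \<phi> t)
          + ennreal ((1 / p) * l powr (1 - p)) * (ennreal (kern b n m t * \<phi> t powr (1 - p)) * ennreal (A m powr p)) \<partial>\<mu>)"
      proof (rule nn_integral_mono)
        fix t assume "t \<in> space \<mu>"
        then have t: "t \<in> {0<..<1}" by (simp add: space_interval)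
        have k: "kern b n m t \<ge> 0" by (rule kern_nonneg[OF b t])
        have "kern b n m t * A m \<le> kern b n m t * ((1 - 1 / p) * (l * \<phi> t) + (1 / p) * ((l * \<phi> t) powr (1 - p) * A m powr p))"
          using l \<phi>[OF t] by (intro mult_left_mono Youngs_inequality_scaled p k A) auto
        also have "\<dots> = ((1 - 1 / p) * l) * (kern b n m t * \<phi> t)
          + ((1 / p) * l powr (1 - p)) * ((kern b n m t * \<phi> t powr (1 - p)) * A m powr p)"
          using l \<phi>[OF t] by (simp add: powr_mult algebra_simps)
        finally have "ennreal (kern b n m t * A m) \<le> ennreal (((1 - 1 / p) * l) * (kern b n m t * \<phi> t)
          + ((1 / p) * l powr (1 - p)) * ((kern b n m t * \<phi> t powr (1 - p)) * A m powr p))"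
          by (rule ennreal_leI)
        also have "\<dots> = ennreal ((1 - 1 / p) * l) * ennreal (kern b n m t * \<phi> t)
          + ennreal ((1 / p) * l powr (1 - p)) * (ennreal (kern b n m t * \<phi> t powr (1 - p)) * ennreal (A m powr p))"
          using l \<phi>[OF t] k p by (intro split) auto
        finally show "ennreal (kern b n m t * A m) \<le> ennreal ((1 - 1 / p) * l) * ennreal (kern b n m t * \<phi> t)
          + ennreal ((1 / p) * l powr (1 - p)) * (ennreal (kern b n m t * \<phi> t powr (1 - p)) * ennreal (A m powr p))" .
      qed
      also have "\<dots> = ennreal ((1 - 1 / p) * l) * q1 n m + ennreal ((1 / p) * l powr (1 - p)) * (q2 n m * ennreal (A m powr p))"
        unfolding q1_def q2_def
        by (subst nn_integral_add) (measurable, simp add: nn_integral_cmult nn_integral_multc)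
      finally show "ennreal (kmat b n m * A m) \<le> ennreal ((1 - 1 / p) * l) * q1 n m
          + ennreal ((1 / p) * l powr (1 - p)) * (q2 n m * ennreal (A m powr p))" .
    qed auto
    also have "\<dots> = ennreal ((1 - 1 / p) * l) * (\<Sum>m. q1 n m) + ennreal ((1 / p) * l powr (1 - p)) * E n"
      unfolding E_def by (subst suminf_add[symmetric]) simp_all
    also have "\<dots> \<le> ennreal ((1 - 1 / p) * l) * ennreal C + ennreal ((1 / p) * l powr (1 - p)) * ennreal (e n)"
      unfolding e by (intro add_right_mono mult_left_mono q1) auto
    also have "\<dots> = ennreal ((1 - 1 / p) * l * C + (1 / p) * l powr (1 - p) * e n)"
      using split[of "(1 - 1 / p) * l" "(1 / p) * l powr (1 - p)" C "e n" 1] l p C e(2)[of n] by simp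
    finally show ?thesis .
  qed
  have nonneg: "kmat b n m * A m \<ge> 0" for n m using kmat_nonneg[OF b] A by simp
  have not_top: "(\<Sum>m. ennreal (kmat b n m * A m)) \<noteq> top" for n
    using X[of 1 n] by (auto simp: top_unique)
  show sm: "summable (\<lambda>m. kmat b n m * A m)" for n
    using nonneg not_top by (rule summable_suminf_not_top)
  define x where "x n = (\<Sum>m. kmat b n m * A m)" for n
  have x: "x n \<ge> 0" for n unfolding x_def by (intro suminf_nonneg sm nonneg)
  have xe: "x n powr p \<le> C powr (p - 1) * e n" for n
  proof (rule Youngs_inequality_optimize[OF p C x e(2)])
    fix l :: real assume l: "l > 0"
    have "ennreal (x n) \<le> ennreal ((1 - 1 / p) * l * C + (1 / p) * l powr (1 - p) * e n)"
      using X[OF l, of n] sm nonneg by (simp add: x_def suminf_ennreal2)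
    moreover have "(1 - 1 / p) * l * C + (1 / p) * l powr (1 - p) * e n \<ge> 0"
      using l p C e(2)[of n] by simp
    ultimately show "x n \<le> (1 - 1 / p) * l * C + (1 / p) * l powr (1 - p) * e n"
      by (simp only: ennreal_le_iff)
  qed
  have "(\<Sum>n. ennreal (wt b n * x n powr p)) \<le> (\<Sum>n. ennreal (C powr (p - 1)) * (ennreal (wt b n) * E n))"
  proof (intro suminf_le)
    fix n
    have "wt b n * x n powr p \<le> C powr (p - 1) * (wt b n * e n)"
      using mult_left_mono[OF xe[of n] w[of n]] by (simp add: mult_ac)
    then have "ennreal (wt b n * x n powr p) \<le> ennreal (C powr (p - 1) * (wt b n * e n))"
      by (rule ennreal_leI)
    also have "\<dots> = ennreal (C powr (p - 1)) * (ennreal (wt b n) * E n)"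
      using w e(2)[of n] by (simp add: ennreal_mult flip: e(1))
    finally show "ennreal (wt b n * x n powr p) \<le> ennreal (C powr (p - 1)) * (ennreal (wt b n) * E n)" .
  qed auto
  \<comment> \<open>The p - 1 powers of C come from the rows and the last one from the
    columns.\<close>
  also have "\<dots> \<le> ennreal (C powr (p - 1)) * ennreal (C * S)"
    unfolding ennreal_suminf_cmult by (intro mult_left_mono E_total) auto
  also have "\<dots> = ennreal (C powr p * S)"
    using C S by (simp add: ennreal_mult'[symmetric] powr_diff)
  finally have le: "(\<Sum>n. ennreal (wt b n * x n powr p)) \<le> ennreal (C powr p * S)" .
  have nn: "wt b n * x n powr p \<ge> 0" for n using w by simp
  have sx: "summable (\<lambda>n. wt b n * x n powr p)"
    using le by (intro summable_suminf_not_top nn) (auto simp: top_unique)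
  then show "summable (\<lambda>n. wt b n * (\<Sum>m. kmat b n m * A m) powr p)"
    by (simp add: x_def)
  have "(\<Sum>n. wt b n * x n powr p) \<le> C powr p * S"
    using le S by (simp add: suminf_ennreal2[OF nn sx] ennreal_le_iff)
  then show "(\<Sum>n. wt b n * (\<Sum>m. kmat b n m * A m) powr p) \<le> C powr p * (\<Sum>m. wt b m * A m powr p)"
    by (simp add: x_def S_def)
qed

end

section \<open>The lower bound\<close>

context interval_measure
begin

definition test_density :: "real \<Rightarrow> real \<Rightarrow> real \<Rightarrow> real" where
  "test_density b s t = (1 - t) powr (-b) * (t / (1 - t)) powr (-s)"

lemma test_density_measurable [measurable]: "test_density b s \<in> borel_measurable borel"
  unfolding test_density_def by measurable

text \<open>Pulling t / (1 - t) out of the Jensen bound leaves the shift (1 - t) / t, which depends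
  on t. On t \<ge> \<delta> it is at most 1 / \<delta>, so the dependence on n factors out of the
  integral.\<close>

lemma suminf_kmat_powr_ge:
  assumes b: "b > 0" and s: "s \<ge> 0" and \<delta>: "0 < \<delta>"
  shows "(\<integral>\<^sup>+t. ennreal (indicator {\<delta>..} t * test_density b s t) \<partial>\<mu>) * ennreal ((real n + (b + 1 / \<delta>)) powr (-s))
    \<le> (\<Sum>m. ennreal (kmat b n m * (real m + 1) powr (-s)))"
proof -
  have "(\<integral>\<^sup>+t. ennreal (indicator {\<delta>..} t * test_density b s t) \<partial>\<mu>) * ennreal ((real n + (b + 1 / \<delta>)) powr (-s))
      = (\<integral>\<^sup>+t. ennreal (indicator {\<delta>..} t * test_density b s t) * ennreal ((real n + (b + 1 / \<delta>)) powr (-s)) \<partial>\<mu>)"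
    by (rule nn_integral_multc[symmetric]) measurable
  also have "\<dots> \<le> (\<integral>\<^sup>+t. (\<Sum>m. ennreal (kern b n m t * (real m + 1) powr (-s))) \<partial>\<mu>)"
  proof (rule nn_integral_mono)
    fix t assume "t \<in> space \<mu>"
    then have t: "t \<in> {0<..<1}" by (simp add: space_interval)
    have "indicator {\<delta>..} t * test_density b s t * (real n + (b + 1 / \<delta>)) powr (-s)
        \<le> (\<Sum>m. kern b n m t * (real m + 1) powr (-s))"
    proof (cases "\<delta> \<le> t")
      case True
      have u: "t / (1 - t) > 0" "0 < (1 - t) / t" using t by auto
      have "(1 - t) / t \<le> 1 / \<delta>"
        using t True \<delta> by (intro frac_le) auto
      then have "(real n + (b + 1 / \<delta>)) powr (-s) \<le> (real n + b + (1 - t) / t) powr (-s)"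
        using b s u by (intro powr_mono2') auto
      then have "test_density b s t * (real n + (b + 1 / \<delta>)) powr (-s) \<le> test_density b s t * (real n + b + (1 - t) / t) powr (-s)"
        by (intro mult_left_mono) (auto simp: test_density_def)
      also have "\<dots> = (1 - t) powr (-b) * ((t / (1 - t)) * (real n + b + (1 - t) / t)) powr (-s)"
        using b u by (subst powr_mult) (auto simp: test_density_def)
      also have "(t / (1 - t)) * (real n + b + (1 - t) / t) = (real n + b) * (t / (1 - t)) + 1"
        using t by (simp add: field_simps)
      also have "(1 - t) powr (-b) * \<dots> powr (-s) \<le> (\<Sum>m. kern b n m t * (real m + 1) powr (-s))"
        by (rule kern_jensen[OF b t s])
      finally show ?thesis using True by simp
    next
      case False
      then show ?thesis
        using kern_nonneg[OF b t] by (auto intro!: suminf_nonneg kern_jensen b t s)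
    qed
    then have "ennreal (indicator {\<delta>..} t * test_density b s t * (real n + (b + 1 / \<delta>)) powr (-s))
        \<le> ennreal (\<Sum>m. kern b n m t * (real m + 1) powr (-s))"
      by (rule ennreal_leI)
    also have "\<dots> = (\<Sum>m. ennreal (kern b n m t * (real m + 1) powr (-s)))"
      using kern_nonneg[OF b t] by (intro suminf_ennreal2[symmetric] kern_jensen b t s) auto
    finally show "ennreal (indicator {\<delta>..} t * test_density b s t) * ennreal ((real n + (b + 1 / \<delta>)) powr (-s))
        \<le> (\<Sum>m. ennreal (kern b n m t * (real m + 1) powr (-s)))"
      by (simp add: ennreal_mult'' flip: ennreal_mult'')
  qed
  also have "\<dots> = (\<Sum>m. ennreal (kmat b n m * (real m + 1) powr (-s)))"
    by (rule suminf_kmat[symmetric, OF b]) simp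
  finally show ?thesis .
qed

text \<open>Testing on (m + 1)^(-s) bounds the truncated integrals by D / \<eta>; the limits in the
  exponent, in \<eta> and in the truncation are then taken in this order.\<close>

lemma kmat_bound_ge:
  assumes p: "p \<ge> 1" and b: "b > 0" and D: "D \<ge> 0"
    and row: "\<And>A n. (\<And>m. A m \<ge> 0) \<Longrightarrow> summable (\<lambda>m. wt b m * A m powr p) \<Longrightarrow>
      summable (\<lambda>m. kmat b n m * A m)"
    and image: "\<And>A. (\<And>m. A m \<ge> 0) \<Longrightarrow> summable (\<lambda>m. wt b m * A m powr p) \<Longrightarrow>
      summable (\<lambda>n. wt b n * (\<Sum>m. kmat b n m * A m) powr p)"
    and bound: "\<And>A. (\<And>m. A m \<ge> 0) \<Longrightarrow> summable (\<lambda>m. wt b m * A m powr p) \<Longrightarrow>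
      (\<Sum>n. wt b n * (\<Sum>m. kmat b n m * A m) powr p) \<le> D powr p * (\<Sum>m. wt b m * A m powr p)"
  shows "(\<integral>\<^sup>+t. ennreal ((1 - t) powr (-(1 - 1 / p) * b) * t powr (-(1 / p) * b)) \<partial>\<mu>) \<le> ennreal D"
proof -
  \<comment> \<open>The same null sequence supplies the increments of the exponent and, at the end,
    the cutoffs \<delta>.\<close>
  define e where "e = (\<lambda>k. inverse (real (Suc k)))"
  have e: "e \<longlonglongrightarrow> 0" "0 < e k" "e k \<le> 1" for k
    unfolding e_def by (rule LIMSEQ_inverse_real_of_nat) (auto simp: field_simps)
  have w: "wt b n > 0" for n by (rule wt_pos[OF b])
  define s where "s k = (b + e k) / p" for k
  have s: "s k \<ge> 0" "s k * p = b + e k" for k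
    using b p e(2)[of k] by (auto simp: s_def)
  define J where "J \<delta> k = (\<integral>\<^sup>+t. ennreal (indicator {\<delta>..} t * test_density b (s k) t) \<partial>\<mu>)" for \<delta> k
  have J: "\<forall>\<^sub>F k in sequentially. J \<delta> k \<le> ennreal (D / \<eta>)"
    if \<delta>: "0 < \<delta>" "\<delta> \<le> 1" and \<eta>: "0 < \<eta>" "\<eta> < 1" for \<delta> \<eta>
  proof -
    define c where "c = b + 1 / \<delta>"
    have c: "c \<ge> 1" using b \<delta> by (simp add: c_def add_increasing)
    \<comment> \<open>The sums compare p-th powers, so the loss \<eta>^p there becomes \<eta> after
      the root is taken.\<close>
    have "\<eta> powr p < 1" using powr_less_mono2[of p \<eta> 1] p \<eta> by simp
    then have "\<forall>\<^sub>F k in sequentially. \<eta> powr p * (\<Sum>n. wt b n * (real n + 1) powr (-(b + e k)))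
        \<le> (\<Sum>n. wt b n * (real n + c) powr (-(b + e k)))"
      using \<eta> by (intro wt_powr_shift_asymp b e c) auto
    then show ?thesis
    proof eventually_elim
      fix k
      assume asymp: "\<eta> powr p * (\<Sum>n. wt b n * (real n + 1) powr (-(b + e k)))
        \<le> (\<Sum>n. wt b n * (real n + c) powr (-(b + e k)))"
      define A where "A m = (real m + 1) powr (- s k)" for m :: nat
      define B where "B n = (\<Sum>m. kmat b n m * A m)" for n
      define S where "S = (\<Sum>n. wt b n * (real n + 1) powr (-(b + e k)))"
      have Ap: "A m powr p = (real m + 1) powr (-(b + e k))" for m
        using s(2)[of k] by (simp add: A_def powr_powr del: minus_add_distrib)
      have A: "A m \<ge> 0" "summable (\<lambda>m. wt b m * A m powr p)" for m
        unfolding Ap using summable_wt_powr[OF b e(2)] by (auto simp: A_def)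
      have S: "S > 0"
        unfolding S_def using w by (intro suminf_pos summable_wt_powr b e(2)) auto
      have rowk: "summable (\<lambda>m. kmat b n m * A m)" for n by (intro row A)
      have JB: "J \<delta> k * ennreal ((real n + c) powr (- s k)) \<le> ennreal (B n)" for n
        using suminf_kmat_powr_ge[OF b s(1) \<delta>(1), of k n] rowk[of n] A(1) kmat_nonneg[OF b]
        by (simp add: J_def c_def B_def A_def suminf_ennreal2)
      \<comment> \<open>The row n = 0 is enough: the real number \<open>B 0\<close> bounds a
        positive multiple of J.\<close>
      have "J \<delta> k \<noteq> top"
        using JB[of 0] c by (auto simp: ennreal_top_mult top_unique)
      then obtain j where j: "J \<delta> k = ennreal j" "j \<ge> 0" by (cases "J \<delta> k") auto
      have B: "B n \<ge> 0" for n
        unfolding B_def using A kmat_nonneg[OF b] by (intro suminf_nonneg rowk) auto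
      have jB: "j powr p * (wt b n * (real n + c) powr (-(b + e k))) \<le> wt b n * B n powr p" for n
      proof -
        have "j * (real n + c) powr (- s k) \<le> B n"
          using JB[of n] j B[of n] by (simp add: ennreal_le_iff flip: ennreal_mult'')
        then have "(j * (real n + c) powr (- s k)) powr p \<le> B n powr p"
          using j p by (intro powr_mono2) auto
        moreover have "(j * (real n + c) powr (- s k)) powr p = j powr p * (real n + c) powr (-(b + e k))"
          using j s(2)[of k] by (simp add: powr_mult powr_powr del: minus_add_distrib)
        ultimately show ?thesis
          using mult_left_mono[OF _ less_imp_le[OF w[of n]]] by (simp add: mult.left_commute del: minus_add_distrib)
      qed
      have "j powr p * (\<eta> powr p * S) \<le> j powr p * (\<Sum>n. wt b n * (real n + c) powr (-(b + e k)))"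
        unfolding S_def by (intro mult_left_mono asymp) auto
      also have "\<dots> = (\<Sum>n. j powr p * (wt b n * (real n + c) powr (-(b + e k))))"
        by (intro suminf_mult[symmetric] summable_wt_powr_shift b e(2) c)
      also have "\<dots> \<le> (\<Sum>n. wt b n * B n powr p)"
        unfolding B_def
        by (intro suminf_le jB[unfolded B_def] summable_mult summable_wt_powr_shift b e(2) c image A)
      also have "\<dots> \<le> D powr p * S"
        using bound[OF A] by (simp add: B_def S_def Ap del: minus_add_distrib)
      finally have "(j * \<eta>) powr p * S \<le> D powr p * S"
        using j \<eta> by (simp add: powr_mult mult.assoc)
      \<comment> \<open>\<open>S\<close> is a positive real number because \<open>e k\<close> is
        positive, so it cancels.\<close>
      then have "(j * \<eta>) powr p \<le> D powr p" using S by simp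
      then have "j * \<eta> \<le> D" using powr_less_mono2[of p D "j * \<eta>"] p D by force
      then show "J \<delta> k \<le> ennreal (D / \<eta>)"
        using \<eta> unfolding j by (intro ennreal_leI) (simp add: field_simps)
    qed
  qed
  define J0 where "J0 \<delta> = (\<integral>\<^sup>+t. ennreal (indicator {\<delta>..} t * test_density b (b / p) t) \<partial>\<mu>)" for \<delta>
  have J0: "J0 \<delta> \<le> ennreal D" if \<delta>: "0 < \<delta>" "\<delta> \<le> 1" for \<delta>
  proof -
    have slim: "s \<longlonglongrightarrow> b / p"
    proof -
      have "(\<lambda>k. (b + e k) / p) \<longlonglongrightarrow> (b + 0) / p"
        using p by (intro tendsto_intros e) auto
      then show ?thesis by (simp add: s_def[abs_def])
    qed
    have "J0 \<delta> = (\<integral>\<^sup>+t. liminf (\<lambda>k. ennreal (indicator {\<delta>..} t * test_density b (s k) t)) \<partial>\<mu>)"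
      unfolding J0_def
    proof (rule nn_integral_cong)
      fix t assume "t \<in> space \<mu>"
      then have t: "t \<in> {0<..<1}" by (simp add: space_interval)
      have "(\<lambda>k. ennreal (indicator {\<delta>..} t * test_density b (s k) t)) \<longlonglongrightarrow> ennreal (indicator {\<delta>..} t * test_density b (b / p) t)"
        unfolding test_density_def using t by (intro tendsto_ennrealI tendsto_intros slim) auto
      then show "ennreal (indicator {\<delta>..} t * test_density b (b / p) t) = liminf (\<lambda>k. ennreal (indicator {\<delta>..} t * test_density b (s k) t))"
        by (intro lim_imp_Liminf[symmetric]) auto
    qed
    \<comment> \<open>Fatou's lemma for the exponents s k tending to b / p, with the cutoff
      fixed.\<close>
    also have "\<dots> \<le> liminf (J \<delta>)"
      unfolding J_def by (rule nn_integral_liminf) measurable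
    finally have J0_le: "J0 \<delta> \<le> liminf (J \<delta>)" .
    have le: "J0 \<delta> \<le> ennreal (D / \<eta>)" if "0 < \<eta>" "\<eta> < 1" for \<eta>
    proof -
      have "liminf (J \<delta>) \<le> liminf (\<lambda>k. ennreal (D / \<eta>))"
        by (rule Liminf_mono[OF J[OF \<delta> that]])
      then show ?thesis using J0_le by (simp add: Liminf_const)
    qed
    \<comment> \<open>The bound holds for each \<eta> < 1, so letting \<eta> tend to 1 removes the
      loss.\<close>
    have "((\<lambda>\<eta>. ennreal (D / \<eta>)) \<longlongrightarrow> ennreal (D / 1)) (at_left 1)"
      by (intro tendsto_ennrealI tendsto_intros) auto
    moreover have "\<forall>\<^sub>F \<eta> in at_left (1::real). J0 \<delta> \<le> ennreal (D / \<eta>)"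
      using eventually_at_left_real[of 0 1] by (rule eventually_mono) (auto intro: le)
    ultimately show ?thesis
      by (intro tendsto_lowerbound[where F = "at_left (1::real)"]) auto
  qed
  \<comment> \<open>The second use of Fatou's lemma removes the cutoff: for fixed t the indicator
    equals 1 as soon as \<open>e k\<close> < t.\<close>
  have "(\<integral>\<^sup>+t. ennreal ((1 - t) powr (-(1 - 1 / p) * b) * t powr (-(1 / p) * b)) \<partial>\<mu>)
      = (\<integral>\<^sup>+t. liminf (\<lambda>k. ennreal (indicator {e k..} t * test_density b (b / p) t)) \<partial>\<mu>)"
  proof (rule nn_integral_cong)
    fix t assume "t \<in> space \<mu>"
    then have t: "t \<in> {0<..<1}" by (simp add: space_interval)
    have "(1 - t) powr (-(1 - 1 / p) * b) * t powr (-(1 / p) * b) = test_density b (b / p) t"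
      using t by (simp add: test_density_def powr_divide powr_minus powr_add[symmetric] powr_diff algebra_simps divide_simps)
    moreover have "(\<lambda>k. ennreal (indicator {e k..} t * test_density b (b / p) t)) \<longlonglongrightarrow> ennreal (test_density b (b / p) t)"
    proof (rule tendsto_eventually)
      have "\<forall>\<^sub>F k in sequentially. e k < t"
        using t by (intro order_tendstoD(2)[OF e(1)]) auto
      then show "\<forall>\<^sub>F k in sequentially. ennreal (indicator {e k..} t * test_density b (b / p) t) = ennreal (test_density b (b / p) t)"
        by eventually_elim simp
    qed
    ultimately show "ennreal ((1 - t) powr (-(1 - 1 / p) * b) * t powr (-(1 / p) * b))
        = liminf (\<lambda>k. ennreal (indicator {e k..} t * test_density b (b / p) t))"
      by (intro lim_imp_Liminf[symmetric]) auto
  qed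
  also have "\<dots> \<le> liminf (\<lambda>k. J0 (e k))"
    unfolding J0_def by (rule nn_integral_liminf) measurable
  also have "\<dots> \<le> liminf (\<lambda>k::nat. ennreal D)"
    by (intro Liminf_mono always_eventually allI J0 e)
  finally show ?thesis by (simp add: Liminf_const)
qed

end

section \<open>The Hilbert operator\<close>

lemma gpoch_pos: "x > 0 \<Longrightarrow> x + s > 0 \<Longrightarrow> gpoch x s > 0"
  by (simp add: gpoch_def Gamma_real_pos)

lemma gpoch_eq_wt: "gpoch (real m + 1) \<beta> = wt (\<beta> + 1) m"
  using Gamma_fact[of m, where 'a=real] by (simp add: gpoch_def wt_def add_ac)

text \<open>On the source side the power -p in the weight is absorbed by dividing the sequence
  entrywise.\<close>

lemma weight1_norm:
  assumes "\<alpha> > -1"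
  shows "weight1 p \<alpha> \<beta> m * norm (a m) powr p
    = wt (\<beta> + 1) m * (norm (a m) / gpoch (real m + 1) \<alpha>) powr p"
proof -
  have "gpoch (real m + 1) \<alpha> > 0" using assms by (intro gpoch_pos) auto
  then show ?thesis
    unfolding weight1_def gpoch_eq_wt by (simp add: powr_divide powr_minus field_simps)
qed

text \<open>On the target side the weight cancels the row factor that \<open>hilbert_term_eq\<close>
  splits off.\<close>

lemma weight2_mult:
  assumes "\<beta> > -1" "\<beta> - \<alpha> > -1"
  shows "weight2 p \<alpha> \<beta> n * (gpoch (real n + \<beta> - \<alpha> + 1) \<alpha> * y) powr p = wt (\<beta> + 1) n * y powr p"
proof -
  have "gpoch (real n + \<beta> - \<alpha> + 1) \<alpha> > 0" using assms by (intro gpoch_pos) auto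
  then show ?thesis
    unfolding weight2_def gpoch_eq_wt by (simp add: powr_mult powr_minus field_simps)
qed

context interval_measure
begin

text \<open>The row factor trades \<Gamma>(n + \<beta> - \<alpha> + 1) for \<Gamma>(n + \<beta> +
  1), and the column factor trades \<Gamma>(m + \<alpha> + 1) for m!. The rest does not involve
  \<alpha>.\<close>

lemma hilbert_term_eq:
  assumes "\<alpha> > -1" "\<beta> > -1" "\<beta> - \<alpha> > -1"
  shows "hilbert_term \<mu> \<alpha> \<beta> a n m
    = complex_of_real (gpoch (real n + \<beta> - \<alpha> + 1) \<alpha> * (kmat (\<beta> + 1) n m / gpoch (real m + 1) \<alpha>)) * a m"
proof -
  define c where "c = gpoch (real n + \<beta> - \<alpha> + 1) \<alpha> / gpoch (real m + 1) \<alpha>"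
  have pos: "Gamma (real n + \<beta> + 1) > 0" "Gamma (real n + \<beta> - \<alpha> + 1) > 0" "Gamma (real m + \<alpha> + 1) > 0"
    using assms by (auto intro!: Gamma_real_pos)
  have arg: "real n + \<beta> - \<alpha> + 1 + \<alpha> = real n + \<beta> + 1" "real m + 1 + \<alpha> = real m + \<alpha> + 1"
    "real n + real m + (\<beta> + 1) = real n + real m + \<beta> + 1" "real n + (\<beta> + 1) = real n + \<beta> + 1"
    by simp_all
  have "Gamma (real n + real m + \<beta> + 1) / (Gamma (real m + \<alpha> + 1) * Gamma (real n + \<beta> - \<alpha> + 1))
      * t ^ m * (1 - t) ^ n = c * kern (\<beta> + 1) n m t" for t
    using pos Gamma_fact[of m, where 'a=real]
    unfolding c_def gpoch_def kern_def arg by (simp add: field_simps)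
  then have "hilbert_term \<mu> \<alpha> \<beta> a n m = (LINT t|\<mu>. complex_of_real (c * kern (\<beta> + 1) n m t) * a m)"
    by (simp only: hilbert_term_def)
  also have "\<dots> = complex_of_real (LINT t|\<mu>. c * kern (\<beta> + 1) n m t) * a m"
    by (subst integral_mult_left_zero) (simp only: integral_complex_of_real)
  also have "(LINT t|\<mu>. c * kern (\<beta> + 1) n m t) = c * kmat (\<beta> + 1) n m"
    by (simp add: kmat_def)
  finally show ?thesis by (simp add: c_def)
qed

text \<open>The matrix has nonnegative entries, so the triangle inequality reduces complex sequences
  to their scaled absolute values, to which \<open>kmat_bound\<close> applies.\<close>

lemma hilbert_lp_bound:
  assumes p: "p \<ge> 1" and \<alpha>: "\<alpha> > -1" and \<beta>: "\<beta> > -1" and \<beta>\<alpha>: "\<beta> - \<alpha> > -1"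
    and C: "C > 0" "C_const \<mu> \<beta> p \<le> ennreal C"
  shows "a \<in> lp_space p (weight1 p \<alpha> \<beta>) \<Longrightarrow> summable (hilbert_term \<mu> \<alpha> \<beta> a n)"
    and "lp_bound p (weight1 p \<alpha> \<beta>) (weight2 p \<alpha> \<beta>) (hilbert_op \<mu> \<alpha> \<beta>) C"
proof -
  define z where "z n = gpoch (real n + \<beta> - \<alpha> + 1) \<alpha>" for n :: nat
  define u where "u m = gpoch (real m + 1) \<alpha>" for m :: nat
  have z: "z n > 0" and u: "u n > 0" for n
    using \<alpha> \<beta> \<beta>\<alpha> by (auto simp: z_def u_def intro!: gpoch_pos)
  have b: "\<beta> + 1 > 0" using \<beta> by simp
  note k = kmat_nonneg[OF b]
  have *: "summable (\<lambda>m. norm (hilbert_term \<mu> \<alpha> \<beta> a n m))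
      \<and> hilbert_op \<mu> \<alpha> \<beta> a \<in> lp_space p (weight2 p \<alpha> \<beta>)
      \<and> lp_norm p (weight2 p \<alpha> \<beta>) (hilbert_op \<mu> \<alpha> \<beta> a) \<le> C * lp_norm p (weight1 p \<alpha> \<beta>) a"
    if a: "a \<in> lp_space p (weight1 p \<alpha> \<beta>)" for a n
  proof -
    define A where "A m = norm (a m) / u m" for m
    define B where "B n = (\<Sum>m. kmat (\<beta> + 1) n m * A m)" for n
    have A: "A m \<ge> 0" for m using u[of m] by (simp add: A_def)
    have w1: "weight1 p \<alpha> \<beta> m * norm (a m) powr p = wt (\<beta> + 1) m * A m powr p" for m
      using weight1_norm[OF \<alpha>] by (simp add: A_def u_def)
    have sA: "summable (\<lambda>m. wt (\<beta> + 1) m * A m powr p)"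
      using a by (simp add: lp_space_def w1)
    have int: "(\<integral>\<^sup>+t. ennreal ((1 - t) powr (-(1 - 1 / p) * (\<beta> + 1)) * t powr (-(1 / p) * (\<beta> + 1))) \<partial>\<mu>)
        \<le> ennreal C"
      using C(2) by (simp only: C_const_def)
    note kb = kmat_bound[OF p b C(1) int A sA]
    have norm_term: "norm (hilbert_term \<mu> \<alpha> \<beta> a n m) = z n * (kmat (\<beta> + 1) n m * A m)" for n m
      using z[of n] u[of m] k[of n m]
      by (simp add: hilbert_term_eq \<alpha> \<beta> \<beta>\<alpha> norm_mult norm_divide A_def flip: z_def u_def)
    have sn: "summable (\<lambda>m. norm (hilbert_term \<mu> \<alpha> \<beta> a n m))" for n
      unfolding norm_term by (intro summable_mult kb)
    have op: "norm (hilbert_op \<mu> \<alpha> \<beta> a n) \<le> z n * B n" for n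
      using summable_norm[OF sn[of n]] kb(1)[of n]
      by (simp add: hilbert_op_def norm_term B_def suminf_mult)
    have w2: "weight2 p \<alpha> \<beta> n \<ge> 0" for n
      using wt_pos[OF b, of n] by (simp add: weight2_def gpoch_eq_wt)
    have le: "weight2 p \<alpha> \<beta> n * norm (hilbert_op \<mu> \<alpha> \<beta> a n) powr p \<le> wt (\<beta> + 1) n * B n powr p" for n
    proof -
      have "weight2 p \<alpha> \<beta> n * norm (hilbert_op \<mu> \<alpha> \<beta> a n) powr p \<le> weight2 p \<alpha> \<beta> n * (z n * B n) powr p"
        using op p by (intro mult_left_mono w2 powr_mono2) auto
      then show ?thesis using weight2_mult[OF \<beta> \<beta>\<alpha>] by (simp add: z_def)
    qed
    have s2: "summable (\<lambda>n. weight2 p \<alpha> \<beta> n * norm (hilbert_op \<mu> \<alpha> \<beta> a n) powr p)"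
      using kb(2) le w2 by (intro summable_comparison_test'[OF kb(2)]) (auto simp: abs_mult B_def)
    have "lp_norm p (weight2 p \<alpha> \<beta>) (hilbert_op \<mu> \<alpha> \<beta> a)
        \<le> (\<Sum>n. wt (\<beta> + 1) n * B n powr p) powr (1 / p)"
      unfolding lp_norm_def using p w2 kb(2)
      by (intro powr_mono2 suminf_le le s2 suminf_nonneg) (auto simp: B_def)
    also have "\<dots> \<le> (C powr p * (\<Sum>m. wt (\<beta> + 1) m * A m powr p)) powr (1 / p)"
      using kb(2,3) p wt_pos[OF b]
      by (intro powr_mono2 suminf_nonneg) (auto simp: B_def less_imp_le)
    also have "\<dots> = C * lp_norm p (weight1 p \<alpha> \<beta>) a"
      using C p by (simp add: lp_norm_def w1 powr_mult powr_powr suminf_nonneg sA wt_pos[OF b] less_imp_le)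
    finally show ?thesis using sn s2 by (simp add: lp_space_def)
  qed
  show "a \<in> lp_space p (weight1 p \<alpha> \<beta>) \<Longrightarrow> summable (hilbert_term \<mu> \<alpha> \<beta> a n)"
    using * by (blast intro: summable_norm_cancel)
  show "lp_bound p (weight1 p \<alpha> \<beta>) (weight2 p \<alpha> \<beta>) (hilbert_op \<mu> \<alpha> \<beta>) C"
    unfolding lp_bound_def using * C(1) by auto
qed

text \<open>On nonnegative sequences no triangle inequality is lost, so a bound for the operator is
  a bound for \<open>kmat\<close> and \<open>kmat_bound_ge\<close> applies.\<close>

lemma hilbert_lp_bound_ge:
  assumes p: "p \<ge> 1" and \<alpha>: "\<alpha> > -1" and \<beta>: "\<beta> > -1" and \<beta>\<alpha>: "\<beta> - \<alpha> > -1"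
    and row: "\<And>a n. a \<in> lp_space p (weight1 p \<alpha> \<beta>) \<Longrightarrow> summable (hilbert_term \<mu> \<alpha> \<beta> a n)"
    and bound: "lp_bound p (weight1 p \<alpha> \<beta>) (weight2 p \<alpha> \<beta>) (hilbert_op \<mu> \<alpha> \<beta>) D"
  shows "C_const \<mu> \<beta> p \<le> ennreal D"
proof -
  define z where "z n = gpoch (real n + \<beta> - \<alpha> + 1) \<alpha>" for n :: nat
  define u where "u m = gpoch (real m + 1) \<alpha>" for m :: nat
  have z: "z n > 0" and u: "u n > 0" for n
    using \<alpha> \<beta> \<beta>\<alpha> by (auto simp: z_def u_def intro!: gpoch_pos)
  have b: "\<beta> + 1 > 0" using \<beta> by simp
  have D: "D \<ge> 0" using bound by (simp add: lp_bound_def)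
  have *: "summable (\<lambda>m. kmat (\<beta> + 1) n m * A m)
      \<and> summable (\<lambda>n. wt (\<beta> + 1) n * (\<Sum>m. kmat (\<beta> + 1) n m * A m) powr p)
      \<and> (\<Sum>n. wt (\<beta> + 1) n * (\<Sum>m. kmat (\<beta> + 1) n m * A m) powr p)
          \<le> D powr p * (\<Sum>m. wt (\<beta> + 1) m * A m powr p)"
    if A: "\<And>m. A m \<ge> 0" and sA: "summable (\<lambda>m. wt (\<beta> + 1) m * A m powr p)" for A n
  proof -
    \<comment> \<open>Multiplying by u undoes the column scaling, so the operator acts on A through
      \<open>kmat\<close> alone, up to the row factor z.\<close>
    define a where "a m = complex_of_real (u m * A m)" for m
    define B where "B n = (\<Sum>m. kmat (\<beta> + 1) n m * A m)" for n
    have w1: "weight1 p \<alpha> \<beta> m * norm (a m) powr p = wt (\<beta> + 1) m * A m powr p" for m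
      using weight1_norm[OF \<alpha>, of p \<beta> m a] u[of m] A[of m] by (simp add: a_def norm_mult flip: u_def)
    have a: "a \<in> lp_space p (weight1 p \<alpha> \<beta>)"
      using sA by (simp add: lp_space_def w1)
    have "hilbert_term \<mu> \<alpha> \<beta> a n m = complex_of_real (z n * (kmat (\<beta> + 1) n m * A m))" for n m
      using u[of m] by (simp add: hilbert_term_eq \<alpha> \<beta> \<beta>\<alpha> a_def flip: z_def u_def)
    then have t: "hilbert_term \<mu> \<alpha> \<beta> a n = (\<lambda>m. complex_of_real (z n * (kmat (\<beta> + 1) n m * A m)))" for n
      by (simp add: fun_eq_iff)
    have sz: "summable (\<lambda>m. z n * (kmat (\<beta> + 1) n m * A m))" for n
      using row[OF a, of n] unfolding t by (simp only: summable_complex_of_real)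
    have sm: "summable (\<lambda>m. kmat (\<beta> + 1) n m * A m)" for n
      using sz[of n] z[of n] by (simp add: summable_cmult_iff)
    have B: "B n \<ge> 0" for n
      unfolding B_def using A kmat_nonneg[OF b] by (intro suminf_nonneg sm) auto
    have op: "hilbert_op \<mu> \<alpha> \<beta> a n = complex_of_real (z n * B n)" for n
      unfolding hilbert_op_def t B_def using sm[of n]
      by (simp only: suminf_of_real summable_mult suminf_mult flip: suminf_of_real)
    have "norm (hilbert_op \<mu> \<alpha> \<beta> a n) = z n * B n" for n
      unfolding op norm_of_real using z[of n] B[of n] by simp
    then have w2: "weight2 p \<alpha> \<beta> n * norm (hilbert_op \<mu> \<alpha> \<beta> a n) powr p = wt (\<beta> + 1) n * B n powr p" for n
      using weight2_mult[OF \<beta> \<beta>\<alpha>, of p n "B n"] by (simp add: z_def)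
    have op_in: "hilbert_op \<mu> \<alpha> \<beta> a \<in> lp_space p (weight2 p \<alpha> \<beta>)"
      and op_le: "lp_norm p (weight2 p \<alpha> \<beta>) (hilbert_op \<mu> \<alpha> \<beta> a) \<le> D * lp_norm p (weight1 p \<alpha> \<beta>) a"
      using bound a by (auto simp: lp_bound_def)
    have sB: "summable (\<lambda>n. wt (\<beta> + 1) n * B n powr p)"
      using op_in by (simp add: lp_space_def w2)
    have nonneg: "(\<Sum>n. wt (\<beta> + 1) n * B n powr p) \<ge> 0" "(\<Sum>m. wt (\<beta> + 1) m * A m powr p) \<ge> 0"
      using wt_pos[OF b] by (auto intro!: suminf_nonneg sA sB simp: less_imp_le)
    have "(\<Sum>n. wt (\<beta> + 1) n * B n powr p) powr (1 / p) \<le> D * (\<Sum>m. wt (\<beta> + 1) m * A m powr p) powr (1 / p)"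
      using op_le by (simp add: lp_norm_def w1 w2)
    then have "((\<Sum>n. wt (\<beta> + 1) n * B n powr p) powr (1 / p)) powr p
        \<le> (D * (\<Sum>m. wt (\<beta> + 1) m * A m powr p) powr (1 / p)) powr p"
      using p by (intro powr_mono2) auto
    then have "(\<Sum>n. wt (\<beta> + 1) n * B n powr p) \<le> D powr p * (\<Sum>m. wt (\<beta> + 1) m * A m powr p)"
      using p D nonneg by (simp add: powr_mult powr_powr)
    then show ?thesis using sm sB by (simp add: B_def)
  qed
  show ?thesis unfolding C_const_def
    by (rule kmat_bound_ge[OF p b D]) (use * in blast)+
qed

end

section \<open>Boundedness criterion and exact norm\<close>

theorem theorem1p3:
  fixes \<mu> :: "real measure" and p \<alpha> \<beta> :: real
  assumes "finite_measure \<mu>"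
    and "sets \<mu> = sets (restrict_space borel {0<..<1})"
    and "1 \<le> p"
    and "\<alpha> > -1" and "\<beta> > -1" and "\<beta> - \<alpha> > -1"
  shows "(hilbert_bounded p (weight1 p \<alpha> \<beta>) (weight2 p \<alpha> \<beta>) \<mu> \<alpha> \<beta> \<longleftrightarrow> C_const \<mu> \<beta> p < \<infinity>)
    \<and> (hilbert_bounded p (weight1 p \<alpha> \<beta>) (weight2 p \<alpha> \<beta>) \<mu> \<alpha> \<beta> \<longrightarrow>
        ennreal (lp_opnorm p (weight1 p \<alpha> \<beta>) (weight2 p \<alpha> \<beta>) (hilbert_op \<mu> \<alpha> \<beta>)) = C_const \<mu> \<beta> p)"
proof -
  interpret interval_measure \<mu>
    using assms(1,2) by (intro interval_measure.intro interval_measure_axioms.intro)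
  let ?v = "weight1 p \<alpha> \<beta>" and ?w = "weight2 p \<alpha> \<beta>" and ?T = "hilbert_op \<mu> \<alpha> \<beta>"
  have lower: "C_const \<mu> \<beta> p \<le> ennreal D"
    if "hilbert_bounded p ?v ?w \<mu> \<alpha> \<beta>" "lp_bound p ?v ?w ?T D" for D
    using that(1) by (intro hilbert_lp_bound_ge[OF assms(3-6) _ that(2)]) (simp add: hilbert_bounded_def)
  have fin: "C_const \<mu> \<beta> p < \<infinity>" if bdd: "hilbert_bounded p ?v ?w \<mu> \<alpha> \<beta>"
  proof -
    obtain D where "lp_bound p ?v ?w ?T D" using bdd by (auto simp: hilbert_bounded_def)
    from lower[OF bdd this] show ?thesis by (simp add: le_less_trans)
  qed
  have upper: "hilbert_bounded p ?v ?w \<mu> \<alpha> \<beta> \<and> lp_bound p ?v ?w ?T (enn2real (C_const \<mu> \<beta> p))"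
    if "C_const \<mu> \<beta> p < \<infinity>"
  proof -
    define c where "c = enn2real (C_const \<mu> \<beta> p)"
    have c: "c \<ge> 0" "C_const \<mu> \<beta> p = ennreal c" using that by (auto simp: c_def)
    \<comment> \<open>The Schur test needs a positive constant, while c is 0 for the zero measure;
      hence the detour through C > c and a limit from the right.\<close>
    have C: "C > 0" "C_const \<mu> \<beta> p \<le> ennreal C" if "C > c" for C
      using that c by (auto intro: ennreal_leI)
    note bd = hilbert_lp_bound[OF assms(3-6) C]
    have "lp_bound p ?v ?w ?T c"
      unfolding lp_bound_def
    proof (intro conjI ballI c(1))
      fix a assume a: "a \<in> lp_space p ?v"
      have le: "?T a \<in> lp_space p ?w \<and> lp_norm p ?w (?T a) \<le> C * lp_norm p ?v a" if "C > c" for C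
        using bd(2)[OF that that] a by (simp add: lp_bound_def)
      show "?T a \<in> lp_space p ?w" using le[of "c + 1"] by simp
      have "((\<lambda>C. C * lp_norm p ?v a) \<longlongrightarrow> c * lp_norm p ?v a) (at_right c)"
        by (intro tendsto_intros)
      moreover have "\<forall>\<^sub>F C in at_right c. lp_norm p ?w (?T a) \<le> C * lp_norm p ?v a"
        using eventually_at_right_less by (rule eventually_mono) (use le in blast)
      ultimately show "lp_norm p ?w (?T a) \<le> c * lp_norm p ?v a"
        by (intro tendsto_lowerbound[where F = "at_right c"]) auto
    qed
    moreover have "summable (hilbert_term \<mu> \<alpha> \<beta> a n)" if "a \<in> lp_space p ?v" for a n
      using hilbert_lp_bound(1)[OF assms(3-6) C(1,2)[of "c + 1"] that] by simp
    ultimately show ?thesis by (auto simp: hilbert_bounded_def c_def)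
  qed
  have "ennreal (lp_opnorm p ?v ?w ?T) = C_const \<mu> \<beta> p" if "hilbert_bounded p ?v ?w \<mu> \<alpha> \<beta>"
  proof -
    have "lp_opnorm p ?v ?w ?T = enn2real (C_const \<mu> \<beta> p)"
      unfolding lp_opnorm_def
    proof (rule Least_equality)
      show "lp_bound p ?v ?w ?T (enn2real (C_const \<mu> \<beta> p))" using upper[OF fin[OF that]] by blast
      show "enn2real (C_const \<mu> \<beta> p) \<le> D" if D: "lp_bound p ?v ?w ?T D" for D
        \<comment> \<open>\<open>ennreal\<close> truncates at 0, so returning to real numbers uses D
          \<ge> 0, which is part of \<open>lp_bound\<close>.\<close>
        using lower[OF \<open>hilbert_bounded p ?v ?w \<mu> \<alpha> \<beta>\<close> D] D by (auto simp: lp_bound_def intro: enn2real_leI)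
    qed
    then show ?thesis using fin[OF that] by simp
  qed
  then show ?thesis using fin upper by blast
qed

end
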